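(* The identities $$x^2=x^4,\qquad xyx=(xy)^3x,\qquad xyxzx=xzxyx,$$ $$(x_1^2x_2^2\cdots x_n^2)^2=(x_1^2x_2^2\cdots x_n^2)^3,\quad n=2,3,\dotsc,$$ form an identity basis for the semigroup $AC_2$; that is, all these identities hold in $AC_2$, and every semigroup identity holding in $AC_2$ follows from them.
   Context: The semigroup $A_2$ is the 5-element semigroup defined, in the class of semigroups with zero, by the presentation $A_2=\langle a,b\mid a^2=aba=a,\ bab=b,\ b^2=0\rangle=\{a,b,ab,ba,0\}$. The semigroup $AC_2$ is the 6-element set $A_2\cup\{c\}$ with $c\notin A_2$, whose multiplication extends that of $A_2$ by the rules $c^2=0$ and $xc=cx=c$ for all $x\in A_2$ (so $0$ is not a zero of $AC_2$, since $0c=c0=c$). A semigroup identity is a pair $u=v$ of non-empty words over an alphabet of variables. It follows from a set $\Sigma$ of identities if it holds in every semigroup that satisfies all identities in $\Sigma$. *)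

theory Defs
  imports Main
begin

section \<open>The semigroups \<open>A\<^sub>2\<close> and \<open>AC\<^sub>2\<close>\<close>

datatype a2 = Zero | Ea | Eb | Eab | Eba

fun a2_mult :: "a2 \<Rightarrow> a2 \<Rightarrow> a2" where
  "a2_mult Zero _ = Zero"
| "a2_mult _ Zero = Zero"
| "a2_mult Ea Ea = Ea"
| "a2_mult Ea Eb = Eab"
| "a2_mult Ea Eab = Eab"
| "a2_mult Ea Eba = Ea"
| "a2_mult Eb Ea = Eba"
| "a2_mult Eb Eb = Zero"
| "a2_mult Eb Eab = Eb"
| "a2_mult Eb Eba = Zero"
| "a2_mult Eab Ea = Ea"
| "a2_mult Eab Eb = Zero"
| "a2_mult Eab Eab = Eab"
| "a2_mult Eab Eba = Zero"
| "a2_mult Eba Ea = Eba"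
| "a2_mult Eba Eb = Eb"
| "a2_mult Eba Eab = Eb"
| "a2_mult Eba Eba = Eba"

lemma semigroup_a2: "semigroup a2_mult"
proof
  fix x y z show "a2_mult (a2_mult x y) z = a2_mult x (a2_mult y z)"
    by (cases x; cases y; cases z) simp_all
qed

text \<open>
  The next two lemmas justify the table: it is the one presented, in the class of semigroups
  with zero, by \<open>\<langle>a, b | a\<^sup>2 = aba = a, bab = b, b\<^sup>2 = 0\<rangle>\<close>. The relations hold, and the table is
  initial among the semigroups with zero having two elements that satisfy them.
\<close>

lemma a2_relations:
  "a2_mult Ea Ea = Ea"
  "a2_mult (a2_mult Ea Eb) Ea = Ea"
  "a2_mult (a2_mult Eb Ea) Eb = Eb"
  "a2_mult Eb Eb = Zero"
  "a2_mult Ea Eb = Eab"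
  "a2_mult Eb Ea = Eba"
  "a2_mult x Zero = Zero"
  "a2_mult Zero x = Zero"
  by (cases x; simp)+

lemma a2_initial:
  fixes f :: "'a \<Rightarrow> 'a \<Rightarrow> 'a" and z a b :: 'a
  assumes "semigroup f"
    and zero: "\<And>x. f z x = z" "\<And>x. f x z = z"
    and rels: "f a a = a" "f (f a b) a = a" "f (f b a) b = b" "f b b = z"
  shows "\<exists>!h. (\<forall>x y. h (a2_mult x y) = f (h x) (h y)) \<and> h Zero = z \<and> h Ea = a \<and> h Eb = b"
proof -
  interpret semigroup f by fact
  have l: "f a (f a x) = f a x" "f a (f b (f a x)) = f a x" "f b (f a (f b x)) = f b x"
    "f b (f b x) = z" for x
    using rels zero by (metis assoc)+
  have r: "f a (f b a) = a" "f b (f a b) = b"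
    using rels by (metis assoc)+
  let ?h = "\<lambda>x. case x of Zero \<Rightarrow> z | Ea \<Rightarrow> a | Eb \<Rightarrow> b | Eab \<Rightarrow> f a b | Eba \<Rightarrow> f b a"
  have hom: "?h (a2_mult x y) = f (?h x) (?h y)" for x y
    by (cases x; cases y) (simp_all add: assoc zero rels l r)
  show ?thesis
  proof (rule ex1I[where a = ?h])
    show "(\<forall>x y. ?h (a2_mult x y) = f (?h x) (?h y)) \<and> ?h Zero = z \<and> ?h Ea = a \<and> ?h Eb = b"
      using hom by simp
  next
    fix g
    assume g: "(\<forall>x y. g (a2_mult x y) = f (g x) (g y)) \<and> g Zero = z \<and> g Ea = a \<and> g Eb = b"
    have "g x = ?h x" for x
      using g g[THEN conjunct1, rule_format, of Ea Eb] g[THEN conjunct1, rule_format, of Eb Ea]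
      by (cases x) simp_all
    then show "g = ?h" by blast
  qed
qed

datatype ac2 = Emb a2 | Ec

fun ac2_mult :: "ac2 \<Rightarrow> ac2 \<Rightarrow> ac2" where
  "ac2_mult (Emb x) (Emb y) = Emb (a2_mult x y)"
| "ac2_mult (Emb x) Ec = Ec"
| "ac2_mult Ec (Emb x) = Ec"
| "ac2_mult Ec Ec = Emb Zero"

lemma semigroup_ac2: "semigroup ac2_mult"
proof
  interpret semigroup a2_mult by (rule semigroup_a2)
  fix x y z show "ac2_mult (ac2_mult x y) z = ac2_mult x (ac2_mult y z)"
    by (cases x; cases y; cases z) (simp_all add: assoc a2_relations)
qed


section \<open>Semigroup identities\<close>

text \<open>Words are lists over the countably infinite alphabet of variables \<open>nat\<close>.\<close>

type_synonym word = "nat list"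
type_synonym identity = "word \<times> word"

definition semigroup_identity :: "identity \<Rightarrow> bool" where
  "semigroup_identity p \<longleftrightarrow> fst p \<noteq> [] \<and> snd p \<noteq> []"

text \<open>The value of the empty word is arbitrary; only non-empty words are ever evaluated.\<close>

fun eval_word :: "('a \<Rightarrow> 'a \<Rightarrow> 'a) \<Rightarrow> (nat \<Rightarrow> 'a) \<Rightarrow> word \<Rightarrow> 'a" where
  "eval_word f \<phi> [] = undefined"
| "eval_word f \<phi> [x] = \<phi> x"
| "eval_word f \<phi> (x # y # w) = f (\<phi> x) (eval_word f \<phi> (y # w))"

definition holds_in :: "('a \<Rightarrow> 'a \<Rightarrow> 'a) \<Rightarrow> identity \<Rightarrow> bool" where
  "holds_in f p \<longleftrightarrow> (\<forall>\<phi>. eval_word f \<phi> (fst p) = eval_word f \<phi> (snd p))"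

text \<open>
  HOL cannot quantify over types inside a formula, so the type carrying the semigroups is an
  argument. A theorem concluding \<open>follows_from TYPE('a) \<Sigma> p\<close> for a type variable \<open>'a\<close> covers
  semigroups of every cardinality.
\<close>

definition follows_from :: "'a itself \<Rightarrow> identity set \<Rightarrow> identity \<Rightarrow> bool" where
  "follows_from _ \<Sigma> p \<longleftrightarrow>
     (\<forall>f :: 'a \<Rightarrow> 'a \<Rightarrow> 'a. semigroup f \<longrightarrow> (\<forall>q\<in>\<Sigma>. holds_in f q) \<longrightarrow> holds_in f p)"


section \<open>The identities\<close>

definition word_pow :: "word \<Rightarrow> nat \<Rightarrow> word" where
  "word_pow w k = concat (replicate k w)"

definition squares_word :: "nat \<Rightarrow> word" where
  "squares_word n = concat (map (\<lambda>i. word_pow [i] 2) [1..<Suc n])"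

definition ac2_identities :: "identity set" where
  "ac2_identities =
     (let x = [0]; y = [1]; z = [2] in
       {(word_pow x 2, word_pow x 4),
        (x @ y @ x, word_pow (x @ y) 3 @ x),
        (x @ y @ x @ z @ x, x @ z @ x @ y @ x)})
     \<union> {(word_pow (squares_word n) 2, word_pow (squares_word n) 3) | n. n \<ge> 2}"

lemma semigroup_identity_ac2_identities:
  "\<forall>p\<in>ac2_identities. semigroup_identity p"
  by (auto simp: ac2_identities_def semigroup_identity_def word_pow_def squares_word_def Let_def
      numeral_eq_Suc)

end

theory Submission
  imports Defs "HOL-Library.Multiset"
begin

text \<open>
  Read a word as a walk: its letters are vertices and its factors of length two are directed edges.
  An identity holds in \<open>AC\<^sub>2\<close> only if its two sides have the same first letter, the same last letter,
  the same set of edges, and agree modulo two in the number of occurrences of each letter. The first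
  three conditions come from \<open>A\<^sub>2\<close>; the last one comes from the substitutions sending a letter to
  \<open>c\<close>, since the value of a word is then \<open>c\<close> or \<open>0\<close> according to a parity
  (\<open>ac2_identity_invariants\<close>). It remains to derive every identity \<open>u = v\<close> with these four properties.

  For a letter \<open>p\<close>, call a word a loop at \<open>p\<close> if it begins with \<open>p\<close> and is followed by \<open>p\<close> in the
  ambient word. The three short identities say that loops at \<open>p\<close> commute and that a loop may be traversed
  two more times (\<open>loops_perm\<close>, \<open>loop_cube\<close>). The loops at \<open>p\<close> thus form a commutative monoid with
  \<open>m\<^sup>3 = m\<close>, a semilattice of groups of exponent two. Three facts then suffice.

  \<^item> A loop absorbs the square of every loop that uses only its edges (\<open>absorb_square\<close>): the
    idempotent of a loop depends only on its set of edges.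

  \<^item> A loop \<open>c\<close> in which every letter occurs an even number of times satisfies \<open>c\<^sup>2 = c\<^sup>3\<close>
    (\<open>even_loop_idem\<close>). This is where the infinite family of identities enters. Modulo squares, \<open>c\<close> is a
    product of standard loops, one for each of its edges. The squares identities say that such a
    product is trivial when the edges form a closed zigzag \<open>q\<^sub>1 p\<^sub>1, q\<^sub>1 p\<^sub>2, q\<^sub>2 p\<^sub>2, q\<^sub>2 p\<^sub>3, \<dots>, q\<^sub>n p\<^sub>1\<close>, and
    a family of edges that enters and leaves each vertex an even number of times is a union of closed
    zigzags.

  \<^item> If the end of a walk \<open>u\<close> is connected back to its beginning along edges of \<open>u\<close>, then \<open>u\<close> equals
    \<open>u P u P u\<close> for a suitable return path \<open>P\<close> (\<open>return_path\<close>).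

  For \<open>u\<close> and \<open>v\<close> as above in the connected case, the loops \<open>c = uP\<close> and \<open>d = vP\<close> have the same edges and
  \<open>cd\<close> is even, whence \<open>u = ccddu = (cd)\<^sup>2u = (cd)\<^sup>3u = cdu = ccv = v\<close>. The general case reduces to this
  one by cutting both walks at the unique edge by which they leave the strong component of their first
  letter.
\<close>

section \<open>Words as walks\<close>

definition edges :: "word \<Rightarrow> (nat \<times> nat) set" where
  "edges w = set (zip w (tl w))"

lemma edges_simps [simp]:
  "edges [] = {}"
  "edges [x] = {}"
  "edges (x # y # w) = insert (x, y) (edges (y # w))"
  by (auto simp: edges_def)

lemma edges_append:
  "u \<noteq> [] \<Longrightarrow> v \<noteq> [] \<Longrightarrow> edges (u @ v) = insert (last u, hd v) (edges u \<union> edges v)"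
proof (induction u)
  case (Cons x u)
  then show ?case by (cases u; cases v) auto
qed simp

lemma edges_append_mono: "edges u \<subseteq> edges (u @ v)" "edges v \<subseteq> edges (u @ v)"
  by (cases "u = []"; cases "v = []"; simp add: edges_append; blast)+

lemma edges_subset_set: "edges w \<subseteq> set w \<times> set w"
  by (induction w rule: induct_list012) auto

lemma edge_split:
  assumes "(y, z) \<in> edges w"
  obtains p q where "w = p @ [y, z] @ q"
  using assms
proof (induction w arbitrary: thesis rule: induct_list012)
  case (3 a b w)
  from 3(4) consider "y = a" "z = b" | "(y, z) \<in> edges (b # w)" by auto
  then show ?case
  proof cases
    case 1
    then show ?thesis using 3(3)[of "[]" w] by simp
  next
    case 2
    then obtain p q where "b # w = p @ [y, z] @ q" using 3(2) by blast
    then show ?thesis using 3(3)[of "a # p" q] by simp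
  qed
qed auto

lemma edges_factor: "edges w \<subseteq> edges (a @ w @ b)"
  using edges_append_mono(1)[of w b] edges_append_mono(2)[of "w @ b" a] by simp

lemma edges_glue: "edges (u @ [p] @ v) = edges (u @ [p]) \<union> edges ([p] @ v)"
  by (cases "u = []"; cases "v = []") (auto simp: edges_append)

text \<open>
  A set of vertices closed under predecessors is left at most once, by a single edge. Hence the edges
  of both parts of the walk, and the edge between them, can be read off from the set of all edges.
\<close>

lemma stays_outside:
  assumes "hd w \<notin> A" "\<And>p q. (p, q) \<in> edges w \<Longrightarrow> q \<in> A \<Longrightarrow> p \<in> A"
  shows "set w \<inter> A = {}"
  using assms by (induction w rule: induct_list012) auto

lemma cut_walk:
  assumes "w \<noteq> []" "hd w \<in> A" "last w \<notin> A"
    and closed: "\<And>p q. (p, q) \<in> edges w \<Longrightarrow> q \<in> A \<Longrightarrow> p \<in> A"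
  obtains w1 w2 where "w = w1 @ w2" "w1 \<noteq> []" "w2 \<noteq> []" "set w1 \<subseteq> A" "set w2 \<inter> A = {}"
proof
  let ?w1 = "takeWhile (\<lambda>a. a \<in> A) w" and ?w2 = "dropWhile (\<lambda>a. a \<in> A) w"
  show w: "w = ?w1 @ ?w2" by simp
  show "?w1 \<noteq> []" using assms(1,2) by (cases w) auto
  show ne: "?w2 \<noteq> []" using assms(1,3) by (auto simp: dropWhile_eq_Nil_conv)
  show "set ?w1 \<subseteq> A" by (auto dest: set_takeWhileD)
  have "edges ?w2 \<subseteq> edges w" using edges_append_mono(2)[of ?w2 ?w1] by simp
  then show "set ?w2 \<inter> A = {}"
    using stays_outside[of ?w2 A] hd_dropWhile[OF ne] closed by blast
qed

lemma edges_of_cut: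
  assumes "w = w1 @ w2" "w1 \<noteq> []" "w2 \<noteq> []" "set w1 \<subseteq> A" "set w2 \<inter> A = {}"
  shows "edges w1 = edges w \<inter> A \<times> A"
    and "edges w2 = edges w \<inter> (- A) \<times> (- A)"
    and "{(last w1, hd w2)} = edges w \<inter> A \<times> (- A)"
    and "count_list w1 a = (if a \<in> A then count_list w a else 0)"
    and "count_list w2 a = (if a \<in> A then 0 else count_list w a)"
proof -
  have e: "edges w = insert (last w1, hd w2) (edges w1 \<union> edges w2)"
    using assms by (simp add: edges_append)
  have "last w1 \<in> A" "hd w2 \<notin> A" using assms by (meson last_in_set hd_in_set disjoint_iff subsetD)+
  moreover have "edges w1 \<subseteq> A \<times> A" using edges_subset_set[of w1] assms(4) by blast
  moreover have "edges w2 \<subseteq> (- A) \<times> (- A)" using edges_subset_set[of w2] assms(5) by blast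
  ultimately show "edges w1 = edges w \<inter> A \<times> A" "edges w2 = edges w \<inter> (- A) \<times> (- A)"
    "{(last w1, hd w2)} = edges w \<inter> A \<times> (- A)"
    unfolding e by auto
  show "count_list w1 a = (if a \<in> A then count_list w a else 0)"
    "count_list w2 a = (if a \<in> A then 0 else count_list w a)"
    using assms by (auto simp: count_list_0_iff)
qed

text \<open>
  A loop at \<open>p\<close> is written without its final \<open>p\<close>, which is the first letter of whatever follows. Thus
  loops at \<open>p\<close> are composed by concatenation, and \<open>starts p\<close> is the condition both on a loop and on the
  remainder of the word behind it.
\<close>

definition starts :: "nat \<Rightarrow> word \<Rightarrow> bool" where
  "starts p w \<longleftrightarrow> (\<exists>w'. w = p # w')"

lemma starts_simps [simp]:
  "\<not> starts p []"
  "starts p (q # w) \<longleftrightarrow> q = p"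
  "starts p w \<Longrightarrow> starts p (w @ v)"
  "starts p w \<Longrightarrow> w \<noteq> []"
  by (auto simp: starts_def)

lemma starts_hd: "w \<noteq> [] \<Longrightarrow> starts (hd w) w"
  by (auto simp: starts_def neq_Nil_conv)

lemma startsE: assumes "starts p w" obtains w' where "w = p # w'"
  using assms by (auto simp: starts_def)


lemma starts_concat_append:
  assumes "\<forall>m\<in>set ms. starts p m" "starts p r"
  shows "starts p (concat ms @ r)"
  using assms by (cases ms) auto


section \<open>Loops commute and have period two\<close>

text \<open>
  The function \<open>val\<close> stands for evaluation of words in a fixed semigroup under a fixed assignment of the
  letters, so that the kernel of \<open>val\<close> is a congruence and every substitution instance of the
  identities holds. The empty word is included, as a unit, in order to avoid case distinctions on
  empty contexts.
\<close>

locale ac2_valuation =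
  fixes val :: "word \<Rightarrow> 'b"
  assumes val_context: "val u = val v \<Longrightarrow> val (a @ u @ b) = val (a @ v @ b)"
    and val_square: "w \<noteq> [] \<Longrightarrow> val (w @ w) = val (w @ w @ w @ w)"
    and val_return: "x \<noteq> [] \<Longrightarrow> y \<noteq> [] \<Longrightarrow> val (x @ y @ x) = val (x @ y @ x @ y @ x @ y @ x)"
    and val_swap: "x \<noteq> [] \<Longrightarrow> y \<noteq> [] \<Longrightarrow> z \<noteq> [] \<Longrightarrow>
      val (x @ y @ x @ z @ x) = val (x @ z @ x @ y @ x)"
    and val_squares: "2 \<le> length ws \<Longrightarrow> [] \<notin> set ws \<Longrightarrow> W = concat (map (\<lambda>w. w @ w) ws) \<Longrightarrow>
      val (W @ W) = val (W @ W @ W)"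
begin

lemma loop_cube:
  assumes "starts p m" "starts p r"
  shows "val (a @ m @ m @ m @ r) = val (a @ m @ r)"
proof -
  obtain y where m: "m = p # y" using assms(1) by (rule startsE)
  obtain r' where r: "r = p # r'" using assms(2) by (rule startsE)
  have "val (m @ m @ m @ [p]) = val (m @ [p])"
    using val_square[of "[p]"] val_return[of "[p]" y] by (cases "y = []") (simp_all add: m)
  from val_context[OF this, of a r'] show ?thesis by (simp add: r)
qed

text \<open>
  The identity \<open>xyxzx = xzxyx\<close> does not allow \<open>y\<close> to be empty. This case is recovered by traversing the
  loop \<open>pz\<close> three times: the trivial loop \<open>p\<close> can be moved past \<open>pz\<close> whenever it has a neighbouring
  \<open>pz\<close> to merge with.
\<close>

lemma swap_trivial_loop:
  assumes "z \<noteq> []"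
  shows "val ([p, p] @ z @ [p]) = val ([p] @ z @ [p, p])"
proof -
  let ?e = "[p]" and ?z = "[p] @ z"
  have left: "val (?e @ ?z @ ?z @ [p]) = val (?z @ ?e @ ?z @ [p])"
    using val_swap[of "[p]" "[p] @ z" z] assms by simp
  have right: "val (?z @ ?e @ ?z @ [p]) = val (?z @ ?z @ ?e @ [p])"
    using val_swap[of "[p]" "z @ [p]" z] assms by simp
  have "val (?e @ ?z @ [p]) = val (?e @ ?z @ ?z @ ?z @ [p])"
    using loop_cube[of p ?z "[p]" ?e] by simp
  also have "\<dots> = val (?z @ ?z @ ?e @ ?z @ [p])"
    using val_context[OF trans[OF left right], of "[]" "z @ [p]"] by simp
  also have "\<dots> = val (?z @ ?z @ ?z @ ?e @ [p])"
    using val_context[OF right, of ?z "[]"] by simp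
  also have "\<dots> = val (?z @ ?e @ [p])"
    using loop_cube[of p ?z "[p, p]" "[]"] by simp
  finally show ?thesis by simp
qed

lemma loop_swap:
  assumes "starts p m" "starts p n" "starts p r"
  shows "val (a @ m @ n @ r) = val (a @ n @ m @ r)"
proof -
  obtain y z r' where e: "m = p # y" "n = p # z" "r = p # r'"
    using assms by (metis startsE)
  have "val (m @ n @ [p]) = val (n @ m @ [p])"
    using val_swap[of "[p]" y z] swap_trivial_loop[of y p] swap_trivial_loop[of z p]
    by (cases "y = []"; cases "z = []") (simp_all add: e)
  from val_context[OF this, of a r'] show ?thesis by (simp add: e)
qed

lemma loops_perm:
  assumes "mset ms = mset ms'" "\<forall>m\<in>set ms. starts p m" "starts p r"
  shows "val (a @ concat ms @ r) = val (a @ concat ms' @ r)"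
  using assms(1,2)
proof (induction ms arbitrary: a ms')
  case (Cons m ms)
  then have "m \<in> set ms'" by (metis list.set_intros(1) set_mset_mset)
  then obtain l1 l2 where l: "ms' = l1 @ m # l2" by (meson split_list)
  have set_eq: "set (m # ms) = set ms'" using Cons.prems(1) by (metis set_mset_mset)
  have "val (a @ concat (m # ms) @ r) = val ((a @ m) @ concat (l1 @ l2) @ r)"
    using Cons.IH[of "l1 @ l2" "a @ m"] Cons.prems l by simp
  also have "\<dots> = val (a @ concat ms' @ r)"
  proof (cases "concat l1")
    case Nil
    then show ?thesis by (simp add: l del: concat_eq_Nil_conv)
  next
    case Cons_l1: (Cons b bs)
    have "starts p (concat l1 @ [p])"
      using set_eq Cons.prems(2) l by (intro starts_concat_append) auto
    then have "starts p (concat l1)" by (simp add: Cons_l1 del: concat_append)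
    moreover have "starts p (concat l2 @ r)"
      using set_eq Cons.prems(2) l assms(3) by (intro starts_concat_append) auto
    ultimately show ?thesis
      using loop_swap[of p m "concat l1" "concat l2 @ r" a] Cons.prems(2) by (simp add: l)
  qed
  finally show ?case .
qed simp

lemma loop_pow_even:
  assumes "starts p m" "starts p r" "even k"
  shows "val (a @ word_pow m k @ m @ r) = val (a @ m @ r)"
proof -
  have "val (a @ word_pow m (2 * j) @ m @ r) = val (a @ m @ r)" for j
  proof (induction j arbitrary: a)
    case (Suc j)
    have "val (a @ word_pow m (2 * Suc j) @ m @ r) = val ((a @ m @ m) @ word_pow m (2 * j) @ m @ r)"
      by (simp add: word_pow_def)
    also have "\<dots> = val ((a @ m @ m) @ m @ r)" by (rule Suc.IH)
    also have "\<dots> = val (a @ m @ r)" using loop_cube[OF assms(1,2), of a] by simp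
    finally show ?case .
  qed (simp add: word_pow_def)
  then show ?thesis using assms(3) by (metis evenE)
qed


section \<open>A loop absorbs the squares of the loops along its edges\<close>

text \<open>
  A walk along edges of the loop \<open>c\<close> is extended letter by letter. When it stands at \<open>y\<close> and the next
  edge is \<open>(y, z)\<close>, the loop \<open>c\<close> passes through this edge, so a rotation of \<open>c\<close> is a loop at \<open>y\<close> that
  starts with \<open>yz\<close>; two copies of it can be supplied by tripling \<open>c\<close>.
\<close>

lemma absorb_walk:
  assumes "starts x c" "starts x d" "edges d \<subseteq> edges (c @ [x])"
  shows "\<exists>r. val (c @ d @ r @ d @ r @ [x]) = val (c @ [x])"
  using assms(2,3)
proof (induction d rule: rev_induct)
  case (snoc z d)
  obtain c' where c': "c = x # c'" using assms(1) by (rule startsE)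
  show ?case
  proof (cases "d = []")
    case True
    then have "z = x" using snoc.prems(1) by simp
    then show ?thesis
      using True loop_cube[of x c "[x]" "[]"] by (intro exI[of _ c']) (simp add: c')
  next
    case False
    obtain e y where d: "d = e @ [y]" using False by (metis append_butlast_last_id)
    have start_d: "starts x d" using False snoc.prems(1) by (cases d) auto
    have edge: "(y, z) \<in> edges (c @ [x])" and "edges d \<subseteq> edges (c @ [x])"
      using snoc.prems(2) edges_append[OF False, of "[z]"] by (auto simp: d)
    then obtain r where r: "val (c @ d @ r @ d @ r @ [x]) = val (c @ [x])"
      using snoc.IH start_d by blast
    from edge obtain p q where pq: "c @ [x] = p @ [y, z] @ q" by (rule edge_split)
    obtain c1 c2 where c: "c = c1 @ [y] @ c2" and z: "hd (c2 @ [x]) = z"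
    proof (cases q rule: rev_cases)
      case Nil
      with pq that[of p "[]"] show ?thesis by simp
    next
      case (snoc q' b)
      with pq that[of p "z # q'"] show ?thesis by simp
    qed
    have "starts z (c2 @ c1 @ [y] @ r)"
    proof (cases c2)
      case Nil
      then show ?thesis using z assms(1) by (cases c1) (auto simp: c)
    qed (use z in simp)
    then obtain r' where r': "c2 @ c1 @ [y] @ r = z # r'" by (rule startsE)
    have r'_append: "c2 @ c1 @ y # r @ w = z # r' @ w" for w
      using arg_cong[OF r', of "\<lambda>u. u @ w"] by simp
    \<comment> \<open>the rotation of \<open>c\<close> that begins with the edge from \<open>y\<close> to \<open>z\<close>\<close>
    let ?M = "[y] @ c2 @ c1"
    have "val (c @ (d @ [z]) @ r' @ (d @ [z]) @ r' @ [x])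
        = val ((c @ e) @ concat [?M, [y] @ r @ e, ?M] @ [y] @ r @ [x])"
      by (simp add: d r'_append)
    also have "\<dots> = val ((c @ e) @ concat [?M, ?M, [y] @ r @ e] @ [y] @ r @ [x])"
      by (rule loops_perm[where p = y]) auto
    also have "\<dots> = val (c1 @ concat [[y] @ c2 @ e, ?M, ?M, [y] @ r @ e] @ [y] @ r @ [x])"
      by (simp add: c)
    also have "\<dots> = val (c1 @ concat [?M, ?M, [y] @ c2 @ e, [y] @ r @ e] @ [y] @ r @ [x])"
      by (rule loops_perm[where p = y]) auto
    also have "\<dots> = val ([] @ c @ c @ c @ d @ r @ d @ r @ [x])"
      by (simp add: c d)
    also have "\<dots> = val ([] @ c @ d @ r @ d @ r @ [x])"
      using assms(1) start_d by (intro loop_cube[where p = x]) auto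
    finally show ?thesis using r by auto
  qed
qed simp

text \<open>
  By the preceding lemma, \<open>c\<close> may be followed by \<open>(dn)\<^sup>2\<close> for some loop \<open>n\<close>. After commuting, this
  contains \<open>d\<^sup>2\<close>, which swallows a further \<open>d\<^sup>2\<close>.
\<close>

lemma absorb_square:
  assumes "starts x c" "starts x d" "edges (d @ [x]) \<subseteq> edges (c @ [x])" "starts x r"
  shows "val (a @ c @ d @ d @ r) = val (a @ c @ r)"
proof -
  obtain s where s: "val (c @ (d @ [x]) @ s @ (d @ [x]) @ s @ [x]) = val (c @ [x])"
    using absorb_walk[of x c "d @ [x]"] assms by auto
  let ?n = "[x] @ s"
  have c: "val (c @ [x]) = val ([] @ concat [c, d, d, ?n, ?n] @ [x])"
    using s loops_perm[of "[c, d, ?n, d, ?n]" "[c, d, d, ?n, ?n]" x "[x]" "[]"] assms by simp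
  have "val (c @ d @ d @ [x]) = val (d @ d @ c @ [x])"
    using loops_perm[of "[c, d, d]" "[d, d, c]" x "[x]" "[]"] assms by simp
  also have "\<dots> = val ([] @ concat [d, d, c, d, d, ?n, ?n] @ [x])"
    using val_context[OF c, of "d @ d" "[]"] by simp
  also have "\<dots> = val ([] @ concat [d, d, d, d, c, ?n, ?n] @ [x])"
    using assms by (intro loops_perm[where p = x]) auto
  also have "\<dots> = val ([] @ concat [d, d, c, ?n, ?n] @ [x])"
    using loop_cube[of x d "d @ c @ ?n @ ?n @ [x]" "[]"] assms by simp
  also have "\<dots> = val ([] @ concat [c, d, d, ?n, ?n] @ [x])"
    using assms by (intro loops_perm[where p = x]) auto
  also have "\<dots> = val (c @ [x])" using c by simp
  finally have "val (c @ d @ d @ [x]) = val (c @ [x])" .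
  moreover obtain r' where "r = x # r'" using assms(4) by (rule startsE)
  ultimately show ?thesis using val_context[of "c @ d @ d @ [x]" "c @ [x]" a r'] by simp
qed

end


section \<open>Even families of edges split into closed zigzags\<close>

text \<open>
  A pair \<open>(q, p)\<close> is regarded as an edge of a bipartite graph with the \<open>q\<close> on one side and the \<open>p\<close> on
  the other. The list \<open>[(q\<^sub>1, p\<^sub>2), (q\<^sub>2, p\<^sub>3), \<dots>]\<close> with starting point \<open>p\<^sub>1\<close> encodes the walk
  \<open>p\<^sub>1, q\<^sub>1, p\<^sub>2, q\<^sub>2, p\<^sub>3, \<dots>\<close> in this graph.
\<close>

fun zigzag :: "'p \<Rightarrow> ('q \<times> 'p) list \<Rightarrow> ('q \<times> 'p) list" where
  "zigzag a [] = []"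
| "zigzag a ((q, p) # B) = (q, a) # (q, p) # zigzag p B"

fun zigzag_end :: "'p \<Rightarrow> ('q \<times> 'p) list \<Rightarrow> 'p" where
  "zigzag_end a [] = a"
| "zigzag_end a ((q, p) # B) = zigzag_end p B"

lemma zigzag_snoc:
  "zigzag a (B @ [(q, p)]) = zigzag a B @ [(q, zigzag_end a B), (q, p)]"
  "zigzag_end a (B @ [(q, p)]) = p"
  by (induction a B rule: zigzag.induct) auto

lemma zigzag_parity:
  "even (count (image_mset fst (mset (zigzag a B))) q)"
  "even (count (image_mset snd (mset (zigzag a B))) p) \<longleftrightarrow> (p = a \<longleftrightarrow> p = zigzag_end a B)"
  by (induction a B rule: zigzag.induct) auto

lemma odd_count_image_mset:
  assumes "odd (count (image_mset f A) y)"
  obtains x A' where "A = add_mset x A'" "f x = y"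
proof -
  have "y \<in># image_mset f A" using assms by (metis even_zero not_in_iff)
  then show thesis using that by (auto dest: multi_member_split)
qed

text \<open>
  Veblen's theorem for bipartite graphs with multiple edges, in the form of an induction principle: if
  all degrees are even, the edges split into closed walks.
\<close>

lemma even_bipartite_induct:
  fixes P :: "('q \<times> 'p) multiset \<Rightarrow> bool"
  assumes zero: "P {#}"
    and closed: "\<And>a B. zigzag_end a B = a \<Longrightarrow> B \<noteq> [] \<Longrightarrow> P (mset (zigzag a B))"
    and add: "\<And>A B. P A \<Longrightarrow> P B \<Longrightarrow> P (A + B)"
    and even: "\<And>q. even (count (image_mset fst A) q)" "\<And>p. even (count (image_mset snd A) p)"
  shows "P A"
proof -
  \<comment> \<open>an unfinished zigzag \<open>B\<close> is set apart and prolonged by edges of \<open>A\<close> until it closes\<close>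
  have "P (A + mset (zigzag a B))"
    if "\<And>q. even (count (image_mset fst A) q)"
      "\<And>p. even (count (image_mset snd (A + mset (zigzag a B))) p)"
    for A a and B :: "('q \<times> 'p) list"
    using that
  proof (induction "size A" arbitrary: A a B rule: less_induct)
    case less
    have extend: "\<exists>A' p'. A = add_mset (q, p) (add_mset (q, p') A')" if qp: "(q, p) \<in># A" for q p
    proof -
      obtain A1 where A1: "A = add_mset (q, p) A1" using qp by (meson multi_member_split)
      then have "odd (count (image_mset fst A1) q)" using less.prems(1)[of q] by simp
      then obtain e A' where e: "A1 = add_mset e A'" "fst e = q" by (rule odd_count_image_mset)
      then have "A = add_mset (q, p) (add_mset (q, snd e) A')" by (auto simp: A1)
      then show ?thesis by blast
    qed
    show ?case
    proof (cases "zigzag_end a B = a")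
      case True
      have B: "P (mset (zigzag a B))" using zero closed[OF True] by (cases "B = []") auto
      have even_A: "even (count (image_mset snd A) p)" for p
        using less.prems(2)[of p] zigzag_parity(2)[where a = a and B = B and p = p] True by auto
      have "P A"
      proof (cases "A = {#}")
        case False
        then obtain q p where "(q, p) \<in># A" by (metis multiset_nonemptyE surj_pair)
        then obtain A' p' where A: "A = add_mset (q, p) (add_mset (q, p') A')"
          using extend by blast
        have "even (count (image_mset fst A') q'')" for q''
          using less.prems(1)[of q''] by (auto simp: A split: if_splits)
        moreover have "even (count (image_mset snd (A' + mset (zigzag p [(q, p')]))) p'')" for p''
          using even_A[of p''] by (simp add: A)
        ultimately have "P (A' + mset (zigzag p [(q, p')]))"
          by (intro less.hyps) (auto simp: A)
        then show ?thesis by (simp add: A)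
      qed (use zero in simp)
      then show ?thesis using B by (rule add)
    next
      case False
      define b where "b = zigzag_end a B"
      have "odd (count (image_mset snd A) b)"
        using less.prems(2)[of b] zigzag_parity(2)[where a = a and B = B and p = b] False
        by (auto simp: b_def)
      then obtain e A1 where "A = add_mset e A1" "snd e = b" by (rule odd_count_image_mset)
      then have "(fst e, b) \<in># A" by auto
      then obtain A' q p' where A: "A = add_mset (q, b) (add_mset (q, p') A')"
        using extend by blast
      have eq: "A + mset (zigzag a B) = A' + mset (zigzag a (B @ [(q, p')]))"
        by (simp add: A zigzag_snoc b_def)
      have "even (count (image_mset fst A') q'')" for q''
        using less.prems(1)[of q''] by (auto simp: A split: if_splits)
      then have "P (A' + mset (zigzag a (B @ [(q, p')])))"
        using less.prems(2) unfolding eq by (intro less.hyps) (auto simp: A)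
      then show ?thesis by (simp only: eq)
    qed
  qed
  from this[where a = undefined and B = "[]", OF even(1)] even(2) show ?thesis by simp
qed


section \<open>Even loops are idempotent\<close>

context ac2_valuation
begin

text \<open>The case of a single square is an instance of \<open>x\<^sup>2 = x\<^sup>4\<close>.\<close>

lemma squares_idem:
  assumes "ws \<noteq> []" "[] \<notin> set ws" "W = concat (map (\<lambda>w. w @ w) ws)"
  shows "val (W @ W) = val (W @ W @ W)"
proof (cases "2 \<le> length ws")
  case False
  then obtain w where "ws = [w]" using assms(1) by (cases ws; cases "tl ws") auto
  then have "W = w @ w" "w \<noteq> []" using assms by auto
  then show ?thesis using val_square[of w] val_context[OF val_square[of w], of "w @ w" "[]"] by simp
qed (use assms val_squares in blast)

text \<open>
  Write \<open>c = \<pi> z \<beta> z\<close> at the first occurrence of \<open>z\<close>. Then \<open>\<alpha> y = \<pi> y y\<close> leads from the base point \<open>x\<close> to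
  \<open>y\<close>, the word \<open>\<beta> z\<close> leads from \<open>z\<close> back to \<open>x\<close>, and \<open>l (y, z) = \<alpha> y \<beta> z\<close> is the standard loop through
  the edge \<open>(y, z)\<close>. Call a loop \<open>Y\<close> trivial if \<open>c\<^sup>2\<close> absorbs it; this is the predicate \<open>T\<close>.

  The product of the standard loops along a closed zigzag is conjugate, by \<open>\<beta>\<close> of its starting point, to
  a product of squares of the words \<open>\<beta> p\<^sub>i \<alpha> q\<^sub>i\<close>, and hence trivial. As every letter is even in \<open>c\<close>, the
  product over all cyclic edges of \<open>c\<close> is trivial, too. That product is \<open>c\<close> with the detour \<open>\<beta> z \<pi> z\<close>
  inserted at all letters \<open>z\<close> but the first one, followed by \<open>c\<close>. Each detour is a rotation of \<open>c\<close> and counts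
  as one more factor \<open>c\<close>, so the product amounts to an odd power of \<open>c\<close>.
\<close>

lemma even_loop_idem:
  assumes x: "starts x c" and even: "\<And>a. even (count_list c a)" and r: "starts x r"
  shows "val (c @ c @ r) = val (c @ c @ c @ r)"
proof -
  define \<alpha> where "\<alpha> y = takeWhile (\<lambda>a. a \<noteq> y) c @ [y]" for y
  define \<beta> where "\<beta> z = dropWhile (\<lambda>a. a \<noteq> z) c" for z
  define \<pi> where "\<pi> z = takeWhile (\<lambda>a. a \<noteq> z) c" for z
  define l where "l = (\<lambda>(y, z). \<alpha> y @ \<beta> z)"
  define F where "F = edges (c @ [x])"
  obtain w where c: "c = x # w" using x by (rule startsE)
  have split: "c = \<pi> z @ \<beta> z" for z by (simp add: \<pi>_def \<beta>_def)
  have start_\<beta>: "starts z (\<beta> z)" if "z \<in> set c" for z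
    using that hd_dropWhile[of "\<lambda>a. a \<noteq> z" c] starts_hd[of "\<beta> z"]
    by (auto simp: \<beta>_def dropWhile_eq_Nil_conv)
  have F_set: "y \<in> set c" "z \<in> set c" if "(y, z) \<in> F" for y z
    using that edges_subset_set[of "c @ [x]"] x by (auto simp: F_def c)
  have start_l: "starts x (l e)" if "e \<in> F" for e
    by (cases e) (auto simp: l_def \<alpha>_def c)
  have edges_l: "edges (l e @ [x]) \<subseteq> F" if "e \<in> F" for e
  proof -
    obtain y z where e: "e = (y, z)" by force
    have "y \<in> set c" "z \<in> set c" using F_set[of y z] that by (simp_all add: e)
    then obtain \<beta>y \<beta>z where \<beta>y: "\<beta> y = y # \<beta>y" and \<beta>z: "\<beta> z = z # \<beta>z"
      using start_\<beta> by (meson startsE)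
    have "c @ [x] = \<alpha> y @ (\<beta>y @ [x])" using split[of y] by (simp add: \<alpha>_def \<pi>_def \<beta>y)
    then have 1: "edges (\<alpha> y) \<subseteq> F" unfolding F_def by (metis edges_append_mono(1))
    have "c @ [x] = \<pi> z @ (\<beta> z @ [x])" using split[of z] by simp
    then have 2: "edges (\<beta> z @ [x]) \<subseteq> F" unfolding F_def by (metis edges_append_mono(2))
    have "edges (\<alpha> y @ (\<beta> z @ [x])) = insert (y, z) (edges (\<alpha> y) \<union> edges (\<beta> z @ [x]))"
      by (subst edges_append) (auto simp: \<alpha>_def \<beta>z)
    then show ?thesis using 1 2 that by (simp add: e l_def)
  qed
  have edges_ls: "edges (concat (map l es) @ [x]) \<subseteq> F" if "set es \<subseteq> F" for es
    using that
  proof (induction es)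
    case (Cons e es)
    have start: "starts x (concat (map l es) @ [x])"
      using Cons.prems by (intro starts_concat_append) (auto intro: start_l)
    then have hd: "hd (concat (map l es) @ [x]) = x" by (auto elim: startsE)
    have "l e \<noteq> []" using start_l[of e] Cons.prems by auto
    then have "edges (l e @ (concat (map l es) @ [x]))
        = insert (last (l e), x) (edges (l e) \<union> edges (concat (map l es) @ [x]))"
      using hd by (subst edges_append) auto
    moreover have "edges (l e @ [x]) = insert (last (l e), x) (edges (l e))"
      using \<open>l e \<noteq> []\<close> by (simp add: edges_append)
    ultimately show ?case using edges_l[of e] Cons by auto
  qed simp

  define T where "T Y \<longleftrightarrow> val (c @ c @ Y @ [x]) = val (c @ c @ [x])" for Y
  have T_append: "T (Y @ Z)" if "T Y" and "T Z" and Z: "starts x Z" for Y Z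
  proof -
    obtain Z' where Z': "Z = x # Z'" using Z by (rule startsE)
    have "val (c @ c @ Y @ Z @ [x]) = val (c @ c @ Z @ [x])"
      using val_context[OF that(1)[unfolded T_def], of "[]" "Z' @ [x]"] by (simp add: Z')
    then show ?thesis using that(2) by (simp add: T_def)
  qed
  have T_perm: "T (concat (map l es'))" if "T (concat (map l es))" and "mset es = mset es'" and "set es \<subseteq> F"
    for es es'
  proof -
    have "val ((c @ c) @ concat (map l es) @ [x]) = val ((c @ c) @ concat (map l es') @ [x])"
      using that by (intro loops_perm[where p = x]) (auto intro: start_l simp: mset_map)
    then show ?thesis using that(1) by (simp add: T_def)
  qed
  have T_closed: "T (concat (map l (zigzag a B)))"
    if "zigzag_end a B = a" and "B \<noteq> []" and F: "set (zigzag a B) \<subseteq> F" for a B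
  proof -
    \<comment> \<open>the words \<open>\<beta> p\<^sub>i \<alpha> q\<^sub>i\<close>, which are squared in the product\<close>
    define ws where "ws a B = map (\<lambda>(p, q). \<beta> p @ \<alpha> q) (zip (a # map snd B) (map fst B))" for a B
    have shift: "\<beta> a @ concat (map l (zigzag a B))
        = concat (map (\<lambda>w. w @ w) (ws a B)) @ \<beta> (zigzag_end a B)" for a B
      by (induction a B rule: zigzag.induct) (auto simp: ws_def l_def)
    let ?Y = "concat (map l (zigzag a B))"
    let ?W = "concat (map (\<lambda>w. w @ w) (ws a B))"
    have "ws a B \<noteq> []" using \<open>B \<noteq> []\<close> by (cases B) (auto simp: ws_def)
    moreover have "[] \<notin> set (ws a B)" by (auto simp: ws_def \<alpha>_def)
    ultimately have W: "val (?W @ ?W) = val (?W @ ?W @ ?W)" by (rule squares_idem) simp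
    have shift': "\<beta> a @ ?Y @ u = ?W @ \<beta> a @ u" for u
      using shift[of a B] that(1) by (metis append.assoc)
    have "val (\<beta> a @ ?Y @ ?Y) = val (\<beta> a @ ?Y @ ?Y @ ?Y)"
      using val_context[OF W, of "[]" "\<beta> a"] shift'[of "[]"] by (simp add: shift')
    \<comment> \<open>the prefix \<open>\<pi> a\<close> completes the conjugating word \<open>\<beta> a\<close> to \<open>c\<close>\<close>
    from val_context[OF this, of "c @ \<pi> a" "[x]"]
    have YY: "val (c @ c @ ?Y @ ?Y @ [x]) = val (c @ c @ ?Y @ ?Y @ ?Y @ [x])"
      using split[of a] by (metis append.assoc)
    obtain q p B' where B: "B = (q, p) # B'" using \<open>B \<noteq> []\<close> by (cases B) auto
    have start_Y: "starts x ?Y" using F start_l by (simp add: B)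
    have absorb: "val (c @ c @ ?Y @ ?Y @ r) = val (c @ c @ r)" if "starts x r" for r
      using absorb_square[OF x start_Y _ that, of c] edges_ls[OF F] by (simp add: F_def)
    show ?thesis
      using YY absorb[of "[x]"] absorb[of "?Y @ [x]"] start_Y by (simp add: T_def)
  qed

  define P where "P A \<longleftrightarrow> set_mset A \<subseteq> F \<longrightarrow> (\<forall>es. mset es = A \<longrightarrow> T (concat (map l es)))" for A
  \<comment> \<open>the edges of the closed walk \<open>c\<close> with their multiplicities\<close>
  define E where "E = zip c (w @ [x])"
  have "P (mset E)"
  proof (rule even_bipartite_induct)
    show "P {#}" by (auto simp: P_def T_def)
  next
    fix a :: nat and B :: "(nat \<times> nat) list"
    assume "zigzag_end a B = a" "B \<noteq> []"
    then show "P (mset (zigzag a B))"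
      using T_closed T_perm unfolding P_def by (metis set_mset_mset)
  next
    fix A B :: "(nat \<times> nat) multiset" assume *: "P A" "P B"
    show "P (A + B)" unfolding P_def
    proof (intro impI allI)
      fix es assume F: "set_mset (A + B) \<subseteq> F" and es: "mset es = A + B"
      obtain as bs where ab: "mset as = A" "mset bs = B" by (metis ex_mset)
      have "T (concat (map l as))" "T (concat (map l bs))" using * F ab by (auto simp: P_def)
      then have "T (concat (map l (as @ bs)))"
        using T_append[of "concat (map l as)" "concat (map l bs)"] F ab start_l
        by (cases bs) auto
      then show "T (concat (map l es))"
        by (rule T_perm) (use es ab F in auto)
    qed
  next
    fix q
    have "image_mset fst (mset E) = mset c" by (simp add: E_def c flip: mset_map)
    then show "even (count (image_mset fst (mset E)) q)" using even[of q] by (simp add: count_mset)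
  next
    fix p
    have "image_mset snd (mset E) = mset c" by (simp add: E_def c flip: mset_map)
    then show "even (count (image_mset snd (mset E)) p)" using even[of p] by (simp add: count_mset)
  qed
  moreover have "set E \<subseteq> F" using zip_append[of "x # w" "w @ [x]" "[x]" "[]"]
    by (simp add: E_def F_def edges_def c)
  ultimately have T_E: "T (concat (map l E))" by (simp add: P_def)

  have unroll: "concat (map l (zip (y # v) (v @ [x])))
      = \<alpha> y @ concat (map (\<lambda>z. \<beta> z @ \<pi> z @ [z]) v) @ \<beta> x" for y v
    by (induction v arbitrary: y) (auto simp: l_def \<alpha>_def \<pi>_def)
  have rotate: "val (a @ c @ e @ \<beta> z @ \<pi> z @ [z] @ s) = val (a @ c @ c @ e @ [z] @ s)"
    if "z \<in> set c" for a e z s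
  proof -
    have "val (a @ c @ e @ \<beta> z @ \<pi> z @ [z] @ s)
        = val ((a @ \<pi> z) @ (\<beta> z @ e) @ (\<beta> z @ \<pi> z) @ [z] @ s)"
      by (subst (1) split[of z]) simp
    also have "\<dots> = val ((a @ \<pi> z) @ (\<beta> z @ \<pi> z) @ (\<beta> z @ e) @ [z] @ s)"
      by (rule loop_swap[where p = z]) (use start_\<beta>[OF that] in simp_all)
    also have "\<dots> = val (a @ (\<pi> z @ \<beta> z) @ (\<pi> z @ \<beta> z) @ e @ [z] @ s)" by simp
    finally show ?thesis by (simp only: flip: split)
  qed
  have rotates: "val (a @ c @ e @ concat (map (\<lambda>z. \<beta> z @ \<pi> z @ [z]) v) @ s)
      = val (a @ word_pow c (length v) @ c @ e @ v @ s)" if "set v \<subseteq> set c" for a e v s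
    using that
  proof (induction v arbitrary: a e)
    case (Cons z v)
    have "val (a @ c @ e @ concat (map (\<lambda>z. \<beta> z @ \<pi> z @ [z]) (z # v)) @ s)
        = val ((a @ c) @ c @ (e @ [z]) @ concat (map (\<lambda>z. \<beta> z @ \<pi> z @ [z]) v) @ s)"
      using rotate[of z a e] Cons.prems by simp
    also have "\<dots> = val ((a @ c) @ word_pow c (length v) @ c @ (e @ [z]) @ v @ s)"
      using Cons by (intro Cons.IH) simp
    finally show ?case by (simp add: word_pow_def)
  qed (simp add: word_pow_def)
  have "even (length c)"
    using even by (simp add: dvd_sum flip: sum_count_set[of c "set c"])
  have "val (c @ c @ [x]) = val (c @ c @ concat (map l E) @ [x])"
    using T_E by (simp add: T_def)
  also have "\<dots> = val (c @ c @ [x] @ concat (map (\<lambda>z. \<beta> z @ \<pi> z @ [z]) w) @ c @ [x])"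
    using unroll[of x w] by (simp add: E_def c \<alpha>_def \<beta>_def)
  also have "\<dots> = val (c @ word_pow c (length w) @ c @ [x] @ w @ c @ [x])"
    by (rule rotates) (auto simp: c)
  also have "\<dots> = val ([] @ word_pow c (length c) @ c @ c @ c @ [x])"
    by (simp add: c word_pow_def)
  also have "\<dots> = val ([] @ c @ c @ c @ [x])"
    by (rule loop_pow_even[where p = x]) (use x \<open>even (length c)\<close> in auto)
  finally have "val (c @ c @ [x]) = val (c @ c @ c @ [x])" by simp
  moreover obtain r' where "r = x # r'" using r by (rule startsE)
  ultimately show ?thesis using val_context[of "c @ c @ [x]" "c @ c @ c @ [x]" "[]" r'] by simp
qed


section \<open>Words with the same ends, edges and letter parities\<close>

text \<open>
  The suffixes \<open>s\<close> of \<open>u\<close> that have a return path \<open>P\<close>, so that \<open>s = s P s P s\<close>, are enlarged step by step.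
  The first one runs between two occurrences of the last letter. As long as \<open>s\<close> does not contain
  all of \<open>u\<close>, connectedness yields a letter \<open>p\<close> that occurs both in \<open>s\<close> and before \<open>s\<close>. Starting at the
  earlier \<open>p\<close> gives a longer suffix, with a return path that runs through \<open>P\<close> and the part of \<open>s\<close> before \<open>p\<close>.
\<close>

lemma return_path:
  assumes "2 \<le> length u" "(last u, hd u) \<in> (edges u)\<^sup>*"
  shows "\<exists>P. val (u @ P @ u @ P @ u) = val u \<and> edges (u @ P @ u) \<subseteq> edges u"
proof -
  define t where "t = last u"
  have "u \<noteq> []" using assms(1) by auto
  have *: "\<exists>P. val (u @ P @ u @ P @ u) = val u \<and> edges (u @ P @ u) \<subseteq> edges u"
    if "u = a @ s" "s \<noteq> []" "val (s @ P @ s @ P @ s) = val s" "edges (s @ P @ s) \<subseteq> edges u"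
    for a s P
    using that
  proof (induction "length a" arbitrary: a s P rule: less_induct)
    case less
    show ?case
    proof (cases "a = []")
      case True
      then show ?thesis using less.prems by auto
    next
      case False
      have "set a \<inter> set s \<noteq> {}"
      proof (cases "hd u \<in> set s")
        case True
        then show ?thesis using False less.prems(1) by (cases a) auto
      next
        case False
        have "t \<in> set s" using less.prems(1,2) by (simp add: t_def)
        \<comment> \<open>the edge by which a walk from the last to the first letter leaves the letters of \<open>s\<close>\<close>
        with assms(2) False have "\<exists>p q. (p, q) \<in> edges u \<and> p \<in> set s \<and> q \<notin> set s"
          unfolding t_def[symmetric] by (induction rule: rtrancl_induct) blast+
        then obtain p q where pq: "(p, q) \<in> edges u" "p \<in> set s" "q \<notin> set s" by blast
        have "edges u = insert (last a, hd s) (edges a \<union> edges s)"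
          using \<open>a \<noteq> []\<close> less.prems(1,2) by (simp add: edges_append)
        then have "(p, q) \<in> edges a"
          using pq edges_subset_set[of s] less.prems(2) by auto
        then show ?thesis using edges_subset_set[of a] pq(2) by auto
      qed
      then obtain p where "p \<in> set a" "p \<in> set s" by blast
      then obtain a1 a2 s1 s2 where as: "a = a1 @ [p] @ a2" "s = s1 @ [p] @ s2"
        by (metis split_list append_Cons append_Nil)
      let ?s = "[p] @ a2 @ s" and ?P = "P @ s1"
      let ?A = "[p] @ a2 @ s1" and ?B = "[p] @ s2 @ P @ s1"
      have "val (?s @ ?P @ ?s @ ?P @ ?s) = val ([] @ concat [?A, ?B, ?A, ?B, ?A] @ [p] @ s2)"
        by (simp add: as)
      also have "\<dots> = val ([] @ concat [?A, ?A, ?A, ?B, ?B] @ [p] @ s2)"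
        by (rule loops_perm[where p = p]) auto
      also have "\<dots> = val ([] @ ?A @ ?B @ ?B @ [p] @ s2)"
        using loop_cube[of p ?A "?B @ ?B @ [p] @ s2" "[]"] by simp
      also have "\<dots> = val (([p] @ a2) @ (s @ P @ s @ P @ s) @ [])" by (simp add: as)
      also have "\<dots> = val (([p] @ a2) @ s @ [])" by (rule val_context) (rule less.prems)
      finally have 1: "val (?s @ ?P @ ?s @ ?P @ ?s) = val ?s" by simp
      have suffix: "edges ?s \<subseteq> edges u"
        using edges_append_mono(2)[of ?s a1] less.prems(1) as(1) by simp
      have "edges (?s @ ?P @ ?s)
          = edges ([p] @ a2 @ s1 @ [p]) \<union> edges ([p] @ s2 @ P @ s1 @ [p]) \<union> edges ?s"
        using edges_glue[of ?A p "s2 @ P @ s1 @ [p] @ a2 @ s"]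
          edges_glue[of "[p] @ s2 @ P @ s1" p "a2 @ s"] by (auto simp: as)
      moreover have "edges ([p] @ a2 @ s1 @ [p]) \<subseteq> edges ?s"
        using edges_append_mono(1)[of "[p] @ a2 @ s1 @ [p]" s2] by (simp add: as)
      moreover have "edges ([p] @ s2 @ P @ s1 @ [p]) \<subseteq> edges (s @ P @ s)"
        using edges_factor[of "[p] @ s2 @ P @ s1 @ [p]" s1 s2] by (simp add: as)
      ultimately have 2: "edges (?s @ ?P @ ?s) \<subseteq> edges u"
        using suffix less.prems(4) by blast
      show ?thesis
        by (rule less.hyps[OF _ _ _ 1 2]) (use less.prems(1) in \<open>simp_all add: as\<close>)
    qed
  qed
  have "t \<in> set (butlast u)"
  proof (cases "t = hd u")
    case True
    then show ?thesis using assms(1) by (cases u) auto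
  next
    case False
    then obtain y where "(t, y) \<in> edges u"
      using assms(2) unfolding t_def by (metis converse_rtranclE)
    then obtain p q where "u = p @ [t, y] @ q" by (rule edge_split)
    then show ?thesis by (simp add: butlast_append)
  qed
  then obtain a m where "butlast u = a @ t # m" by (meson split_list)
  then have u: "u = a @ ([t] @ m @ [t])"
    using \<open>u \<noteq> []\<close> append_butlast_last_id[of u] by (simp add: t_def)
  let ?s = "[t] @ m @ [t]"
  have "val (?s @ m @ ?s @ m @ ?s) = val ?s"
    using loop_cube[of t "[t] @ m" "[t] @ m @ [t] @ m @ [t]" "[]"]
      loop_cube[of t "[t] @ m" "[t]" "[]"] by simp
  moreover have "edges (?s @ m @ ?s) = edges ?s"
    using edges_glue[of "[t] @ m" t "m @ ?s"] edges_glue[of "[t] @ m" t "m @ [t]"] by auto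
  then have "edges (?s @ m @ ?s) \<subseteq> edges u"
    using edges_append_mono(2)[of ?s a] u by simp
  ultimately show ?thesis using *[OF u] by simp
qed

text \<open>
  The loops \<open>uP\<close>, \<open>vP\<close> and \<open>vQ\<close> at the first letter all have the edges of \<open>u\<close>, so each of them absorbs the
  squares of the others. In particular, the return path \<open>Q\<close> of \<open>v\<close> can be replaced by that of \<open>u\<close>.
\<close>

lemma connected_walks_eq:
  assumes ne: "u \<noteq> []" "v \<noteq> []"
    and ends: "hd u = hd v" "last u = last v"
    and edges: "edges u = edges v"
    and parity: "\<And>a. even (count_list u a) = even (count_list v a)"
    and connected: "(last u, hd u) \<in> (edges u)\<^sup>*"
  shows "val u = val v"
proof (cases "2 \<le> length u \<and> 2 \<le> length v")
  case False
  then have "edges u = {}"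
    using ne edges by (cases u; cases v; cases "tl u"; cases "tl v") auto
  then show ?thesis
    using ne edges ends by (cases u; cases v; cases "tl u"; cases "tl v") auto
next
  case True
  define h where "h = hd u"
  define t where "t = last u"
  obtain P where P: "val (u @ P @ u @ P @ u) = val u" "edges (u @ P @ u) \<subseteq> edges u"
    using return_path True connected by blast
  obtain Q where Q: "val (v @ Q @ v @ Q @ v) = val v" "edges (v @ Q @ v) \<subseteq> edges v"
    using return_path[of v] True connected ends edges by auto
  obtain u' v' where u: "u = h # u'" and v: "v = h # v'"
    using ne ends by (metis h_def list.collapse)
  obtain u0 v0 where u0: "u = u0 @ [t]" and v0: "v = v0 @ [t]"
    using ne ends by (metis t_def append_butlast_last_id)
  let ?c = "u @ P" and ?d = "v @ P" and ?q = "v @ Q"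
  have start [simp]: "starts h u" "starts h v" by (simp_all add: u v)
  have Ec: "edges (?c @ [h]) = edges u"
    using edges_append_mono(1)[of "?c @ [h]" u'] P(2) edges_append_mono(1)[of u "P @ [h]"]
    by (simp add: u)
  have Eq: "edges (?q @ [h]) = edges u"
    using edges_append_mono(1)[of "?q @ [h]" v'] Q(2) edges_append_mono(1)[of v "Q @ [h]"] edges
    by (simp add: v)
  have Ed: "edges (?d @ [h]) = edges u"
    using Ec edges ends ne edges_append[of u "P @ [h]"] edges_append[of v "P @ [h]"] by auto
  have absorb: "val (a @ m @ n @ n @ r) = val (a @ m @ r)"
    if "starts h m" "starts h n" "edges (m @ [h]) = edges u" "edges (n @ [h]) = edges u"
      "starts h r" for a m n r
    by (rule absorb_square) (use that in auto)
  have perm: "val (concat ms @ r) = val (concat ms' @ r)"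
    if "mset ms = mset ms'" "\<forall>m\<in>set ms. starts h m" "starts h r" for ms ms' r
    using loops_perm[OF that, of "[]"] by simp

  have v_dd: "val (?d @ ?d @ v) = val v"
  proof -
    have "val v = val (?q @ ?q @ v)" using Q by simp
    also have "\<dots> = val (?q @ ?q @ ?d @ ?d @ v)"
      using absorb[of ?q ?d v ?q] Eq Ed by simp
    also have "\<dots> = val (?d @ ?d @ ?q @ ?q @ v)"
      using perm[of "[?q, ?q, ?d, ?d]" "[?d, ?d, ?q, ?q]" v] by simp
    also have "\<dots> = val (?d @ ?d @ v)"
      using absorb[of ?d ?q v ?d] Eq Ed by simp
    finally show ?thesis by simp
  qed
  have "val u = val (?c @ ?c @ u)" using P by simp
  also have "\<dots> = val (?c @ ?c @ ?d @ ?d @ u)"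
    using absorb[of ?c ?d u ?c] Ec Ed by simp
  also have "\<dots> = val ((?c @ ?d) @ (?c @ ?d) @ u)"
    using perm[of "[?c, ?c, ?d, ?d]" "[?c, ?d, ?c, ?d]" u] by simp
  also have "\<dots> = val ((?c @ ?d) @ (?c @ ?d) @ (?c @ ?d) @ u)"
    by (rule even_loop_idem[where x = h]) (use parity in auto)
  also have "\<dots> = val (?c @ ?c @ ?c @ ?d @ ?d @ ?d @ u)"
    using perm[of "[?c, ?d, ?c, ?d, ?c, ?d]" "[?c, ?c, ?c, ?d, ?d, ?d]" u] by simp
  also have "\<dots> = val (?c @ ?d @ u)"
    using loop_cube[of h ?c "?d @ ?d @ ?d @ u" "[]"] loop_cube[of h ?d u ?c] by simp
  \<comment> \<open>the final \<open>u\<close> is exchanged with a \<open>v\<close> by commuting two loops at the last letter\<close>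
  also have "\<dots> = val (u0 @ ([t] @ P @ v0) @ ([t] @ P @ u0) @ [t])"
    by (simp add: u0 v0)
  also have "\<dots> = val (u0 @ ([t] @ P @ u0) @ ([t] @ P @ v0) @ [t])"
    by (rule loop_swap[where p = t]) auto
  also have "\<dots> = val (?c @ ?c @ v)" by (simp add: u0 v0)
  also have "\<dots> = val (?c @ ?c @ ?d @ ?d @ v)"
    using absorb[of ?c ?d v ?c] Ec Ed by simp
  also have "\<dots> = val (?d @ ?d @ ?c @ ?c @ v)"
    using perm[of "[?c, ?c, ?d, ?d]" "[?d, ?d, ?c, ?c]" v] by simp
  also have "\<dots> = val (?d @ ?d @ v)"
    using absorb[of ?d ?c v ?d] Ec Ed by simp
  finally show ?thesis using v_dd by simp
qed

lemma same_walk_invariants_eq: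
  assumes "u \<noteq> []" "v \<noteq> []" "hd u = hd v" "last u = last v" "edges u = edges v"
    and "\<And>a. even (count_list u a) = even (count_list v a)"
  shows "val u = val v"
  using assms
proof (induction "length u" arbitrary: u v rule: less_induct)
  case less
  \<comment> \<open>the strong component of the first letter\<close>
  define A where "A = {y. (y, hd u) \<in> (edges u)\<^sup>*}"
  have A: "hd u \<in> A" "\<And>p q. (p, q) \<in> edges u \<Longrightarrow> q \<in> A \<Longrightarrow> p \<in> A"
    by (auto simp: A_def intro: converse_rtrancl_into_rtrancl)
  show ?case
  proof (cases "last u \<in> A")
    case True
    then show ?thesis using less.prems by (intro connected_walks_eq) (auto simp: A_def)
  next
    case False
    obtain u1 u2 where u: "u = u1 @ u2" "u1 \<noteq> []" "u2 \<noteq> []" "set u1 \<subseteq> A" "set u2 \<inter> A = {}"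
      using cut_walk[of u A] less.prems(1) False A by metis
    obtain v1 v2 where v: "v = v1 @ v2" "v1 \<noteq> []" "v2 \<noteq> []" "set v1 \<subseteq> A" "set v2 \<inter> A = {}"
      using cut_walk[of v A] less.prems(2-5) False A by metis
    note eu = edges_of_cut[OF u] and ev = edges_of_cut[OF v]
    have "{(last u1, hd u2)} = {(last v1, hd v2)}"
      unfolding eu(3) ev(3) less.prems(5) ..
    then have bridge: "last u1 = last v1" "hd u2 = hd v2" by simp_all
    have "hd u1 = hd v1" "last u2 = last v2" using u(1-3) v(1-3) less.prems(3,4) by simp_all
    moreover have "edges u1 = edges v1" "edges u2 = edges v2"
      unfolding eu(1,2) ev(1,2) less.prems(5) by (rule refl)+
    moreover have "even (count_list u1 a) = even (count_list v1 a)"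
      "even (count_list u2 a) = even (count_list v2 a)" for a
      unfolding eu(4,5) ev(4,5) using less.prems(6)[of a] by simp_all
    moreover have "length u1 < length u" "length u2 < length u" using u(1-3) by simp_all
    ultimately have "val u1 = val v1" "val u2 = val v2"
      using less.hyps[of u1 v1] less.hyps[of u2 v2] u(2,3) v(2,3) bridge by blast+
    then show ?thesis
      using val_context[of u1 v1 "[]" u2] val_context[of u2 v2 v1 "[]"] u(1) v(1) by simp
  qed
qed

end


section \<open>Equational consequences\<close>

lemma eval_word_append:
  assumes "semigroup f" "u \<noteq> []" "v \<noteq> []"
  shows "eval_word f \<phi> (u @ v) = f (eval_word f \<phi> u) (eval_word f \<phi> v)"
proof -
  interpret semigroup f by fact
  show ?thesis
    using assms(2)
  proof (induction u rule: induct_list012)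
    case (2 x)
    then show ?case using assms(3) by (cases v) auto
  qed (auto simp: assoc)
qed

lemma eval_word_substitution:
  assumes "semigroup f" "w \<noteq> []" "\<forall>x\<in>set w. \<sigma> x \<noteq> []"
  shows "eval_word f \<phi> (concat (map \<sigma> w)) = eval_word f (\<lambda>x. eval_word f \<phi> (\<sigma> x)) w"
  using assms(2,3)
proof (induction w rule: induct_list012)
  case (3 x y w)
  then show ?case
    using eval_word_append[OF assms(1), of "\<sigma> x" "\<sigma> y @ concat (map \<sigma> w)" \<phi>] by auto
qed auto

lemma holds_in_substitution:
  assumes "semigroup f" "holds_in f (u, v)" "u \<noteq> []" "v \<noteq> []" "\<And>x. \<sigma> x \<noteq> []"
  shows "eval_word f \<phi> (concat (map \<sigma> u)) = eval_word f \<phi> (concat (map \<sigma> v))"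
  using assms eval_word_substitution[of f u \<sigma> \<phi>] eval_word_substitution[of f v \<sigma> \<phi>]
  by (simp add: holds_in_def)

lemma squares_word_substitution:
  assumes "\<And>i. i < length ws \<Longrightarrow> \<sigma> (Suc i) = ws ! i"
  shows "concat (map \<sigma> (squares_word (length ws))) = concat (map (\<lambda>w. w @ w) ws)"
proof -
  have "concat (map \<sigma> (squares_word n)) = concat (map (\<lambda>w. w @ w) (map \<sigma> [1..<Suc n]))" for n
    by (induction n) (auto simp: squares_word_def word_pow_def numeral_eq_Suc)
  moreover have "map \<sigma> [1..<Suc (length ws)] = ws"
    using assms by (intro nth_equalityI) (auto simp del: upt_Suc)
  ultimately show ?thesis by (simp only:)
qed

text \<open>The value \<open>None\<close> of the empty word plays the role of an adjoined unit.\<close>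

lemma ac2_valuation_eval:
  fixes f :: "'a \<Rightarrow> 'a \<Rightarrow> 'a"
  assumes f: "semigroup f" and "\<forall>q\<in>ac2_identities. holds_in f q"
  shows "ac2_valuation (\<lambda>w. if w = [] then None else Some (eval_word f \<phi> w))"
proof -
  have "holds_in f ([0, 0], [0, 0, 0, 0])" "holds_in f ([0, 1, 0], [0, 1, 0, 1, 0, 1, 0])"
    "holds_in f ([0, 1, 0, 2, 0], [0, 2, 0, 1, 0])"
    using assms(2) by (auto simp: ac2_identities_def Let_def word_pow_def numeral_eq_Suc)
  note inst = this[THEN holds_in_substitution[OF f]]
  have squares: "holds_in f (word_pow (squares_word n) 2, word_pow (squares_word n) 3)"
    if "n \<ge> 2" for n
    using assms(2) that by (auto simp: ac2_identities_def)
  show ?thesis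
  proof (unfold_locales, goal_cases)
    case (1 u v a b)
    then show ?case
      by (cases "a = []"; cases "b = []") (auto simp: eval_word_append[OF f] split: if_splits)
  next
    case (2 w)
    then show ?case using inst(1)[of "\<lambda>_. w" \<phi>] by simp
  next
    case (3 x y)
    then show ?case using inst(2)[of "\<lambda>i. if i = 0 then x else y" \<phi>] by simp
  next
    case (4 x y z)
    then show ?case
      using inst(3)[of "\<lambda>i. if i = 0 then x else if i = 1 then y else z" \<phi>] by simp
  next
    case (5 ws W)
    define \<sigma> where "\<sigma> i = (if 1 \<le> i \<and> i \<le> length ws then ws ! (i - 1) else [0])" for i
    have ne: "\<sigma> i \<noteq> []" for i
    proof (cases "1 \<le> i \<and> i \<le> length ws")
      case True
      then have "\<sigma> i \<in> set ws" by (auto simp: \<sigma>_def)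
      then show ?thesis using 5(2) by metis
    qed (auto simp: \<sigma>_def simp del: One_nat_def)
    have W: "concat (map \<sigma> (squares_word (length ws))) = W"
      using squares_word_substitution[of ws \<sigma>] 5(3) by (simp add: \<sigma>_def)
    have "word_pow (squares_word (length ws)) k \<noteq> []" if "k > 0" for k
      using 5(1) that by (cases k) (auto simp: word_pow_def squares_word_def)
    then have "eval_word f \<phi> (concat (map \<sigma> (word_pow (squares_word (length ws)) 2)))
        = eval_word f \<phi> (concat (map \<sigma> (word_pow (squares_word (length ws)) 3)))"
      using squares[OF 5(1)] ne by (intro holds_in_substitution[OF f]) auto
    then show ?case by (auto simp: word_pow_def numeral_eq_Suc W)
  qed
qed


section \<open>The identities of \<open>AC\<^sub>2\<close>\<close>

text \<open>
  Apart from zero, \<open>A\<^sub>2\<close> is a Rees matrix semigroup with two rows and two columns whose sandwich matrix has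
  a single zero entry: an element is a pair of bits, and the product of two of them is zero exactly if
  the right bit of the first and the left bit of the second are both set. A word is therefore
  evaluated to zero as soon as it has an edge from a letter with right bit to a letter with left bit.
\<close>

fun a2_of_bits :: "bool \<Rightarrow> bool \<Rightarrow> a2" where
  "a2_of_bits False False = Ea"
| "a2_of_bits False True = Eab"
| "a2_of_bits True False = Eba"
| "a2_of_bits True True = Eb"

lemma a2_mult_of_bits:
  "a2_mult (a2_of_bits l r) (a2_of_bits l' r') = (if r \<and> l' then Zero else a2_of_bits l r')"
  by (cases l; cases r; cases l'; cases r') auto

lemma a2_of_bits_eq_iff:
  "a2_of_bits l r \<noteq> Zero" "a2_of_bits l r = a2_of_bits l' r' \<longleftrightarrow> l = l' \<and> r = r'"
  by (cases l; cases r; cases l'; cases r'; simp)+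

lemma eval_word_bits:
  assumes "w \<noteq> []"
  shows "eval_word ac2_mult (\<lambda>x. Emb (a2_of_bits (L x) (R x))) w
    = Emb (if \<exists>(y, z)\<in>edges w. R y \<and> L z then Zero else a2_of_bits (L (hd w)) (R (last w)))"
  using assms by (induction w rule: induct_list012) (auto simp: a2_mult_of_bits a2_relations)

lemma eval_word_parity:
  assumes "w \<noteq> []"
  shows "eval_word ac2_mult (\<lambda>x. if x = a then Ec else Emb Zero) w
    = (if odd (count_list w a) then Ec else Emb Zero)"
  using assms by (induction w rule: induct_list012) auto

lemma ac2_identity_invariants:
  assumes "holds_in ac2_mult (u, v)" "u \<noteq> []" "v \<noteq> []"
  shows "hd u = hd v" "last u = last v" "edges u = edges v"
    "even (count_list u a) = even (count_list v a)"
proof -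
  have eq: "eval_word ac2_mult \<phi> u = eval_word ac2_mult \<phi> v" for \<phi>
    using assms(1) by (simp add: holds_in_def)
  have bits: "(\<exists>(y, z)\<in>edges u. R y \<and> L z) = (\<exists>(y, z)\<in>edges v. R y \<and> L z)"
    "\<not> (\<exists>(y, z)\<in>edges u. R y \<and> L z) \<Longrightarrow> L (hd u) = L (hd v) \<and> R (last u) = R (last v)" for L R
    using eq[of "\<lambda>x. Emb (a2_of_bits (L x) (R x))"] assms(2,3)
    by (auto simp: eval_word_bits a2_of_bits_eq_iff a2_of_bits_eq_iff(1)[symmetric] split: if_splits)
  show "hd u = hd v" using bits(2)[of "\<lambda>_. False" "\<lambda>x. x = hd u"] by auto
  show "last u = last v" using bits(2)[of "\<lambda>x. x = last u" "\<lambda>_. False"] by auto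
  show "edges u = edges v"
  proof (intro set_eqI)
    fix e
    show "e \<in> edges u \<longleftrightarrow> e \<in> edges v"
      using bits(1)[of "\<lambda>y. y = fst e" "\<lambda>z. z = snd e"] by (cases e) auto
  qed
  show "even (count_list u a) = even (count_list v a)"
    using eq[of "\<lambda>x. if x = a then Ec else Emb Zero"] assms(2,3)
    by (simp add: eval_word_parity split: if_splits)
qed

text \<open>
  The square of any element of \<open>AC\<^sub>2\<close> lies in \<open>A\<^sub>2\<close>, where \<open>s\<^sup>2 = s\<^sup>3\<close> for all \<open>s\<close>. This settles the
  infinite family of identities.
\<close>

lemma a2_identities:
  "a2_mult x x = a2_mult x (a2_mult x x)"
  "a2_mult x (a2_mult y x) = a2_mult x (a2_mult y (a2_mult x (a2_mult y (a2_mult x (a2_mult y x)))))"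
  "a2_mult x (a2_mult y (a2_mult x (a2_mult z x))) = a2_mult x (a2_mult z (a2_mult x (a2_mult y x)))"
  by (cases x; cases y; cases z; simp)+

lemma ac2_small_identities:
  "ac2_mult x x = ac2_mult x (ac2_mult x (ac2_mult x x))"
  "ac2_mult x (ac2_mult y x)
    = ac2_mult x (ac2_mult y (ac2_mult x (ac2_mult y (ac2_mult x (ac2_mult y x)))))"
  "ac2_mult x (ac2_mult y (ac2_mult x (ac2_mult z x)))
    = ac2_mult x (ac2_mult z (ac2_mult x (ac2_mult y x)))"
  by (cases x; cases y; cases z; simp add: a2_relations flip: a2_identities)+

lemma ac2_square_in_a2: "\<exists>s. ac2_mult x x = Emb s"
  by (cases x) auto

lemma eval_squares_word_in_a2: "\<exists>s. eval_word ac2_mult \<phi> (squares_word (Suc n)) = Emb s"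
proof (induction n)
  case 0
  then show ?case using ac2_square_in_a2 by (simp add: squares_word_def word_pow_def numeral_eq_Suc)
next
  case (Suc n)
  have "squares_word (Suc (Suc n)) = squares_word (Suc n) @ [Suc (Suc n), Suc (Suc n)]"
    "squares_word (Suc n) \<noteq> []"
    by (simp_all add: squares_word_def word_pow_def numeral_eq_Suc)
  then have "eval_word ac2_mult \<phi> (squares_word (Suc (Suc n))) =
    ac2_mult (eval_word ac2_mult \<phi> (squares_word (Suc n)))
      (ac2_mult (\<phi> (Suc (Suc n))) (\<phi> (Suc (Suc n))))"
    by (simp add: eval_word_append[OF semigroup_ac2])
  then show ?case
    using Suc ac2_square_in_a2[of "\<phi> (Suc (Suc n))"] by auto
qed

lemma ac2_identities_hold:
  assumes "p \<in> ac2_identities"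
  shows "holds_in ac2_mult p"
proof -
  from assms consider
      "p \<in> {([0, 0], [0, 0, 0, 0]), ([0, 1, 0], [0, 1, 0, 1, 0, 1, 0]),
        ([0, 1, 0, 2, 0], [0, 2, 0, 1, 0])}"
    | n where "n \<ge> 2" "p = (word_pow (squares_word n) 2, word_pow (squares_word n) 3)"
    by (auto simp: ac2_identities_def Let_def word_pow_def numeral_eq_Suc)
  then show ?thesis
  proof cases
    case 1
    then show ?thesis by (auto simp: holds_in_def intro: ac2_small_identities)
  next
    case 2
    have ne: "squares_word n \<noteq> []"
      using 2(1) by (cases n) (auto simp: squares_word_def word_pow_def)
    have "eval_word ac2_mult \<phi> (word_pow (squares_word n) 2)
        = eval_word ac2_mult \<phi> (word_pow (squares_word n) 3)" for \<phi>
    proof -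
      obtain s where "eval_word ac2_mult \<phi> (squares_word n) = Emb s"
        using 2(1) eval_squares_word_in_a2[of \<phi> "n - 1"] by auto
      then show ?thesis
        using ne a2_identities(1)[of s]
        by (simp add: word_pow_def numeral_eq_Suc eval_word_append[OF semigroup_ac2])
    qed
    then show ?thesis by (simp add: holds_in_def 2(2))
  qed
qed

lemma follows_from_ac2_identities:
  assumes "semigroup_identity p" "holds_in ac2_mult p"
  shows "follows_from TYPE('a) ac2_identities p"
  unfolding follows_from_def
proof (intro allI impI)
  fix f :: "'a \<Rightarrow> 'a \<Rightarrow> 'a"
  assume f: "semigroup f" "\<forall>q\<in>ac2_identities. holds_in f q"
  obtain u v where p: "p = (u, v)" by force
  then have ne: "u \<noteq> []" "v \<noteq> []" using assms(1) by (simp_all add: semigroup_identity_def)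
  have "eval_word f \<phi> u = eval_word f \<phi> v" for \<phi>
  proof -
    interpret ac2_valuation "\<lambda>w. if w = [] then None else Some (eval_word f \<phi> w)"
      using f by (rule ac2_valuation_eval)
    show ?thesis
      using same_walk_invariants_eq[OF ne] ac2_identity_invariants[of u v] assms(2) ne p by simp
  qed
  then show "holds_in f p" by (simp add: holds_in_def p)
qed

theorem theorem1:
  "(\<forall>p\<in>ac2_identities. holds_in ac2_mult p) \<and>
   (\<forall>p. semigroup_identity p \<and> holds_in ac2_mult p \<longrightarrow>
        follows_from TYPE('a) ac2_identities p)"
  using ac2_identities_hold follows_from_ac2_identities by blast

end
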